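(* Let $A=(a_{ij})\in M_n(\mathbb{R}_+)$ and let $k$ be an integer with $1\le k<n$. Then $$W_{\max}^k(A)=[c,d],$$ where $c=\min\{\max_{1\le j\le k} a_{i_ji_j} : 1\le i_1<i_2<\cdots<i_k\le n\}$ and $d=\max_{1\le i,j\le n}a_{ij}$. Moreover, $$W_{\max}^n(A)=\Big\{\max_{1\le i\le n}a_{ii}\Big\}.$$
   Context: $\mathbb{R}_+$ is the set of nonnegative reals, $M_{m\times n}(\mathbb{R}_+)$ the set of $m\times n$ matrices with nonnegative real entries, and $M_n(\mathbb{R}_+)=M_{n\times n}(\mathbb{R}_+)$. Max algebra: $a\oplus b=\max\{a,b\}$, and for matrices of compatible sizes $(A\otimes B)_{ij}=\max_l a_{il}b_{lj}$. For a square matrix, $tr_\otimes(A)=\max_i a_{ii}$. For $1\le k\le n$ let $\mathcal{X}_{n\times k}=\{X\in M_{n\times k}(\mathbb{R}_+): X^t\otimes X=I_k\}$, with $I_k$ the usual identity matrix. The max $k$-numerical range of $A\in M_n(\mathbb{R}_+)$ is $W_{\max}^k(A)=\{tr_\otimes(X^t\otimes A\otimes X): X\in\mathcal{X}_{n\times k}\}=\{\max_{1\le i\le k}(x^{(i)})^t\otimes A\otimes x^{(i)}: X=[x^{(1)},\dots,x^{(k)}]\in\mathcal{X}_{n\times k}\}$, where $x^{(i)}$ are the columns of $X$. *)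

theory Defs
  imports Complex_Main "Jordan_Normal_Form.Matrix"
begin

text \<open>Matrices are those of \<^theory>\<open>Jordan_Normal_Form.Matrix\<close>: rows and columns are
  numbered from 0, and the set of m by n real matrices is \<open>carrier_mat m n\<close>.\<close>

definition nonneg_mat :: "real mat \<Rightarrow> bool" where
  "nonneg_mat A \<longleftrightarrow> (\<forall>i<dim_row A. \<forall>j<dim_col A. 0 \<le> A $$ (i, j))"

text \<open>The maxima below range over \<open>{..<dim_col A}\<close> and \<open>{..<dim_row A}\<close>, so the next two
  operations are meaningful only when that dimension is positive; \<open>Max {}\<close> is unspecified.\<close>

definition max_mat_mult :: "real mat \<Rightarrow> real mat \<Rightarrow> real mat"  (infixl "\<otimes>\<^sub>m\<^sub>a\<^sub>x" 70) where
  "A \<otimes>\<^sub>m\<^sub>a\<^sub>x B =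
     mat (dim_row A) (dim_col B) (\<lambda>(i, j). Max ((\<lambda>l. A $$ (i, l) * B $$ (l, j)) ` {..<dim_col A}))"

definition max_trace :: "real mat \<Rightarrow> real" where
  "max_trace A = Max ((\<lambda>i. A $$ (i, i)) ` {..<dim_row A})"

definition max_isometries :: "nat \<Rightarrow> nat \<Rightarrow> real mat set" where
  "max_isometries n k =
     {X \<in> carrier_mat n k. nonneg_mat X \<and> transpose_mat X \<otimes>\<^sub>m\<^sub>a\<^sub>x X = 1\<^sub>m k}"

definition max_numerical_range :: "nat \<Rightarrow> real mat \<Rightarrow> real set" where
  "max_numerical_range k A =
     {max_trace (transpose_mat X \<otimes>\<^sub>m\<^sub>a\<^sub>x A \<otimes>\<^sub>m\<^sub>a\<^sub>x X) | X. X \<in> max_isometries (dim_row A) k}"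

end

theory Submission
  imports Defs "HOL-Library.Infinite_Set"
begin

text \<open>
  The equation \<open>X\<^sup>t \<otimes> X = I\<close> says that the columns of the nonnegative matrix \<open>X\<close> have disjoint
  supports and that the largest entry of each column is 1. The number attached to \<open>X\<close> is the
  largest product \<open>x\<^sub>r\<^sub>j a\<^sub>r\<^sub>s x\<^sub>s\<^sub>j\<close>. All entries of \<open>X\<close> are at most 1, so this number is at most \<open>d\<close>.
  Choosing in each column \<open>j\<close> a row \<open>\<sigma> j\<close> with entry 1 gives an injection \<open>\<sigma>\<close>, by disjointness of
  the supports, and the number is at least \<open>max\<^sub>j a\<^sub>\<sigma>\<^sub>j\<^sub>,\<^sub>\<sigma>\<^sub>j\<close>, hence at least \<open>c\<close>. For \<open>k = n\<close> the
  injection \<open>\<sigma>\<close> uses every row, \<open>X\<close> is a permutation matrix, and the number is the largest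
  diagonal entry.

  For \<open>k < n\<close>, intermediate values come from continuity. Start at the 0/1 matrix of an injection
  \<open>\<sigma>\<close> and raise, within one column, the entries in some rows that \<open>\<sigma>\<close> does not use from 0 to 1. The
  matrix stays admissible, so every value between the two ends is attained
  (\<open>values_along_fill_path\<close>). Let \<open>\<sigma>\<close> attain \<open>c\<close> and let \<open>a\<^sub>p\<^sub>q = d\<close>. If \<open>p\<close> and \<open>q\<close> can be put into a
  common column, because \<open>p = q\<close> or \<open>\<sigma>\<close> uses at most one of them, one such path runs from \<open>c\<close> to
  \<open>d\<close> (\<open>values_up_to_entry\<close>). If \<open>\<sigma>\<close> uses both, in different columns, then a row \<open>e\<close> outside the
  image of \<open>\<sigma>\<close> exists since \<open>k < n\<close>. Moving \<open>q\<close>'s column to \<open>e\<close> gives an injection \<open>\<tau>\<close> that leaves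
  \<open>q\<close> free, from which \<open>d\<close> can be reached. The path from \<open>\<sigma>\<close> that raises \<open>e\<close> in \<open>q\<close>'s column ends at a
  value no smaller than the starting value of \<open>\<tau>\<close>, so the two paths together cover all of \<open>[c, d]\<close>.
\<close>

section \<open>Maxima over finite sets\<close>

lemma mult_Max_image:
  fixes f :: "'a \<Rightarrow> real"
  assumes "finite S" "S \<noteq> {}" "0 \<le> c"
  shows "Max (f ` S) * c = Max ((\<lambda>x. f x * c) ` S)"
proof -
  have "mono (\<lambda>y. y * c)"
    using assms(3) by (auto intro!: monoI mult_right_mono)
  from mono_Max_commute[OF this, of "f ` S"] assms show ?thesis
    by (simp add: image_image)
qed

lemma continuous_on_Max_image:
  fixes f :: "'a \<Rightarrow> 'b :: topological_space \<Rightarrow> real"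
  assumes "finite S" "S \<noteq> {}" "\<And>x. x \<in> S \<Longrightarrow> continuous_on T (f x)"
  shows "continuous_on T (\<lambda>t. Max ((\<lambda>x. f x t) ` S))"
  using assms
proof (induction S rule: finite_ne_induct)
  case (singleton x)
  then show ?case by simp
next
  case (insert x F)
  then show ?case by (auto intro!: continuous_on_max)
qed

section \<open>Isometries and the values they give\<close>

text \<open>Off the diagonal, \<open>X\<^sup>t \<otimes> X\<close> has maxima of nonnegative products, which vanish only if every
  product does; on the diagonal it has the largest square of each column.\<close>

lemma max_isometries_iff:
  assumes n: "n \<ge> 1"
  shows "X \<in> max_isometries n k \<longleftrightarrow>
    X \<in> carrier_mat n k \<and> (\<forall>r<n. \<forall>j<k. 0 \<le> X $$ (r, j) \<and> X $$ (r, j) \<le> 1) \<and>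
    (\<forall>j<k. \<exists>r<n. X $$ (r, j) = 1) \<and>
    (\<forall>r<n. \<forall>i<k. \<forall>j<k. i \<noteq> j \<longrightarrow> X $$ (r, i) * X $$ (r, j) = 0)"
    (is "_ \<longleftrightarrow> ?R")
proof -
  define g where "g i j = Max ((\<lambda>l. X $$ (l, i) * X $$ (l, j)) ` {..<n})" for i j
  have ne: "{..<n} \<noteq> {}" using n by (auto simp: lessThan_empty_iff)
  have gram: "transpose_mat X \<otimes>\<^sub>m\<^sub>a\<^sub>x X = 1\<^sub>m k \<longleftrightarrow>
      (\<forall>i<k. \<forall>j<k. g i j = (if i = j then 1 else 0))" if "X \<in> carrier_mat n k"
  proof -
    have "transpose_mat X \<otimes>\<^sub>m\<^sub>a\<^sub>x X = mat k k (\<lambda>(i, j). g i j)"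
      using that unfolding max_mat_mult_def g_def
      by (intro eq_matI) (auto intro!: arg_cong[where f = Max] image_cong)
    then show ?thesis
      by (auto simp: mat_eq_iff)
  qed
  show ?thesis
  proof
    assume "X \<in> max_isometries n k"
    then have X: "X \<in> carrier_mat n k" and nn: "\<And>r j. r < n \<Longrightarrow> j < k \<Longrightarrow> 0 \<le> X $$ (r, j)"
      and g: "\<And>i j. i < k \<Longrightarrow> j < k \<Longrightarrow> g i j = (if i = j then 1 else 0)"
      using gram by (auto simp: max_isometries_def nonneg_mat_def)
    have le_g: "X $$ (r, i) * X $$ (r, j) \<le> g i j" if "r < n" for r i j
      using that unfolding g_def by (intro Max_ge) auto
    have "X $$ (r, j) \<le> 1" if "r < n" "j < k" for r j
      using le_g[of r j j] g[of j j] that nn[of r j]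
      by (simp add: power2_eq_square[symmetric] power_le_one_iff)
    moreover have "\<exists>r<n. X $$ (r, j) = 1" if j: "j < k" for j
    proof -
      have "g j j \<in> (\<lambda>l. X $$ (l, j) * X $$ (l, j)) ` {..<n}"
        unfolding g_def using ne by (intro Max_in) auto
      then obtain r where r: "r < n" "X $$ (r, j) * X $$ (r, j) = 1"
        using g[of j j] j by auto
      with nn[of r j] j show ?thesis
        by (auto simp: square_eq_1_iff)
    qed
    moreover have "X $$ (r, i) * X $$ (r, j) = 0" if "r < n" "i < k" "j < k" "i \<noteq> j" for r i j
      using le_g[of r i j] g[of i j] that nn[of r i] nn[of r j]
      by (intro antisym) auto
    ultimately show ?R using X nn by (intro conjI allI impI) simp_all
  next
    assume R: ?R
    then have ex: "\<forall>j<k. \<exists>r<n. X $$ (r, j) = 1" by (elim conjE)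
    have "g i j = (if i = j then 1 else 0)" if ij: "i < k" "j < k" for i j
    proof (cases "i = j")
      case True
      obtain r where r: "r < n" "X $$ (r, j) = 1" using ex ij by auto
      have "g j j = 1"
        unfolding g_def
      proof (rule Max_eqI)
        show "1 \<in> (\<lambda>l. X $$ (l, j) * X $$ (l, j)) ` {..<n}"
          using r by (intro image_eqI[of _ _ r]) auto
      next
        fix y assume "y \<in> (\<lambda>l. X $$ (l, j) * X $$ (l, j)) ` {..<n}"
        then show "y \<le> 1" using R ij by (auto intro!: mult_le_one)
      qed auto
      with True show ?thesis by simp
    next
      case False
      then have "(\<lambda>l. X $$ (l, i) * X $$ (l, j)) ` {..<n} = {0}"
        using R ij ne by (auto simp: image_iff)
      with False show ?thesis by (simp add: g_def)
    qed
    with R gram show "X \<in> max_isometries n k"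
      by (auto simp: max_isometries_def nonneg_mat_def)
  qed
qed

text \<open>A single maximum over a finite set of products lets bounds and continuity be checked one
  product at a time.\<close>

definition max_form :: "real mat \<Rightarrow> nat \<Rightarrow> nat \<Rightarrow> real mat \<Rightarrow> real" where
  "max_form A n k X =
    Max ((\<lambda>(j, r, s). X $$ (r, j) * A $$ (r, s) * X $$ (s, j)) ` ({..<k} \<times> {..<n} \<times> {..<n}))"

lemma max_form_ge:
  assumes "j < k" "r < n" "s < n"
  shows "X $$ (r, j) * A $$ (r, s) * X $$ (s, j) \<le> max_form A n k X"
  unfolding max_form_def using assms by (intro Max_ge) force+

lemma max_form_le:
  assumes "n \<ge> 1" "k \<ge> 1"
    and "\<And>j r s. j < k \<Longrightarrow> r < n \<Longrightarrow> s < n \<Longrightarrow> X $$ (r, j) * A $$ (r, s) * X $$ (s, j) \<le> b"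
  shows "max_form A n k X \<le> b"
proof -
  have "(0, 0, 0) \<in> {..<k} \<times> {..<n} \<times> {..<n}" using assms(1,2) by auto
  then have "{..<k} \<times> {..<n} \<times> {..<n} \<noteq> {}" by blast
  then show ?thesis
    unfolding max_form_def by (subst Max_le_iff) (use assms(3) in auto)
qed

text \<open>Multiplication by a nonnegative entry of \<open>X\<close> commutes with the inner maximum, so the nested
  maxima of the trace collapse into one.\<close>

lemma max_trace_eq_max_form:
  assumes n: "n \<ge> 1" and k: "k \<ge> 1" and A: "A \<in> carrier_mat n n" and X: "X \<in> carrier_mat n k"
    and nn: "\<And>r j. r < n \<Longrightarrow> j < k \<Longrightarrow> 0 \<le> X $$ (r, j)"
  shows "max_trace (transpose_mat X \<otimes>\<^sub>m\<^sub>a\<^sub>x A \<otimes>\<^sub>m\<^sub>a\<^sub>x X) = max_form A n k X"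
proof -
  have nen: "{..<n} \<noteq> {}" and nek: "{..<k} \<noteq> {}" using n k by (auto simp: lessThan_empty_iff)
  define h where "h j s = Max ((\<lambda>r. X $$ (r, j) * A $$ (r, s) * X $$ (s, j)) ` {..<n})" for j s
  have entry: "(transpose_mat X \<otimes>\<^sub>m\<^sub>a\<^sub>x A) $$ (j, s) * X $$ (s, j) = h j s" if "j < k" "s < n" for j s
  proof -
    have "(transpose_mat X \<otimes>\<^sub>m\<^sub>a\<^sub>x A) $$ (j, s) = Max ((\<lambda>r. X $$ (r, j) * A $$ (r, s)) ` {..<n})"
      using that A X by (auto simp: max_mat_mult_def intro!: arg_cong[where f = Max] image_cong)
    then show ?thesis
      unfolding h_def using mult_Max_image[OF _ nen nn[OF that(2,1)]] by simp
  qed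
  have diag: "(transpose_mat X \<otimes>\<^sub>m\<^sub>a\<^sub>x A \<otimes>\<^sub>m\<^sub>a\<^sub>x X) $$ (j, j) = Max (h j ` {..<n})" if "j < k" for j
  proof -
    have dim: "dim_row (transpose_mat X \<otimes>\<^sub>m\<^sub>a\<^sub>x A) = k" "dim_col (transpose_mat X \<otimes>\<^sub>m\<^sub>a\<^sub>x A) = n"
      using A X by (auto simp: max_mat_mult_def)
    show ?thesis
      unfolding max_mat_mult_def[of "transpose_mat X \<otimes>\<^sub>m\<^sub>a\<^sub>x A"]
      using that X dim entry by (auto intro!: arg_cong[where f = Max] image_cong)
  qed
  have row: "dim_row (transpose_mat X \<otimes>\<^sub>m\<^sub>a\<^sub>x A \<otimes>\<^sub>m\<^sub>a\<^sub>x X) = k"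
    using X by (simp add: max_mat_mult_def)
  have tr: "max_trace (transpose_mat X \<otimes>\<^sub>m\<^sub>a\<^sub>x A \<otimes>\<^sub>m\<^sub>a\<^sub>x X) = Max ((\<lambda>j. Max (h j ` {..<n})) ` {..<k})"
    unfolding max_trace_def row using diag by (auto intro!: arg_cong[where f = Max] image_cong)
  show ?thesis
    unfolding tr
  proof (rule antisym)
    have "h j s \<le> max_form A n k X" if "j < k" "s < n" for j s
      unfolding h_def using that nen max_form_ge by (subst Max_le_iff) auto
    then show "Max ((\<lambda>j. Max (h j ` {..<n})) ` {..<k}) \<le> max_form A n k X"
      using nen nek by (subst Max_le_iff) (auto simp: Max_le_iff)
    have "X $$ (r, j) * A $$ (r, s) * X $$ (s, j) \<le> Max ((\<lambda>j. Max (h j ` {..<n})) ` {..<k})"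
      if "j < k" "r < n" "s < n" for j r s
    proof -
      have "X $$ (r, j) * A $$ (r, s) * X $$ (s, j) \<le> h j s"
        unfolding h_def using that by (intro Max_ge) auto
      also have "\<dots> \<le> Max (h j ` {..<n})" using that by (intro Max_ge) auto
      also have "\<dots> \<le> Max ((\<lambda>j. Max (h j ` {..<n})) ` {..<k})" using that by (intro Max_ge) auto
      finally show ?thesis .
    qed
    then show "max_form A n k X \<le> Max ((\<lambda>j. Max (h j ` {..<n})) ` {..<k})"
      using n k by (intro max_form_le)
  qed
qed

lemma max_numerical_range_eq:
  assumes "n \<ge> 1" "k \<ge> 1" "A \<in> carrier_mat n n"
  shows "max_numerical_range k A = max_form A n k ` max_isometries n k"
proof -
  have "max_trace (transpose_mat X \<otimes>\<^sub>m\<^sub>a\<^sub>x A \<otimes>\<^sub>m\<^sub>a\<^sub>x X) = max_form A n k X"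
    if "X \<in> max_isometries n k" for X
    using that assms max_isometries_iff[OF assms(1), of X k] by (intro max_trace_eq_max_form) auto
  then show ?thesis
    using assms(3) unfolding max_numerical_range_def by force
qed

section \<open>Bounds\<close>

definition max_diag :: "real mat \<Rightarrow> nat \<Rightarrow> (nat \<Rightarrow> nat) \<Rightarrow> real" where
  "max_diag A k \<sigma> = Max ((\<lambda>j. A $$ (\<sigma> j, \<sigma> j)) ` {..<k})"

lemma max_diag_ge: "j < k \<Longrightarrow> A $$ (\<sigma> j, \<sigma> j) \<le> max_diag A k \<sigma>"
  unfolding max_diag_def by (intro Max_ge) auto

lemma max_diag_le_iff: "k \<ge> 1 \<Longrightarrow> max_diag A k \<sigma> \<le> b \<longleftrightarrow> (\<forall>j<k. A $$ (\<sigma> j, \<sigma> j) \<le> b)"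
  unfolding max_diag_def by (subst Max_le_iff) (auto simp: lessThan_empty_iff)

lemma max_diag_cong_image:
  assumes "\<sigma> ` {..<k} = \<tau> ` {..<k}"
  shows "max_diag A k \<sigma> = max_diag A k \<tau>"
  using arg_cong[where f = "\<lambda>S. Max ((\<lambda>r. A $$ (r, r)) ` S)", OF assms]
  by (simp add: max_diag_def image_image)

lemma max_diag_le_max_form:
  assumes "k \<ge> 1" "\<And>j. j < k \<Longrightarrow> \<sigma> j < n" "\<And>j. j < k \<Longrightarrow> X $$ (\<sigma> j, j) = 1"
  shows "max_diag A k \<sigma> \<le> max_form A n k X"
proof -
  have "A $$ (\<sigma> j, \<sigma> j) \<le> max_form A n k X" if "j < k" for j
    using max_form_ge[of j k "\<sigma> j" n "\<sigma> j" X A] assms(2,3) that by simp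
  with assms(1) show ?thesis by (simp add: max_diag_le_iff)
qed

lemma max_form_selection_le:
  assumes n: "n \<ge> 1" and k: "k \<ge> 1" and A: "A \<in> carrier_mat n n" "nonneg_mat A"
    and \<sigma>: "\<And>j. j < k \<Longrightarrow> \<sigma> j < n"
    and X: "\<And>r j. r < n \<Longrightarrow> j < k \<Longrightarrow> X $$ (r, j) = (if r = \<sigma> j then 1 else 0)"
  shows "max_form A n k X \<le> max_diag A k \<sigma>"
proof (rule max_form_le[OF n k])
  fix j r s assume *: "j < k" "r < n" "s < n"
  have "0 \<le> A $$ (\<sigma> j, \<sigma> j)" using A \<sigma> * by (auto simp: nonneg_mat_def)
  with max_diag_ge[OF *(1), of A \<sigma>] *
  show "X $$ (r, j) * A $$ (r, s) * X $$ (s, j) \<le> max_diag A k \<sigma>"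
    by (auto simp: X)
qed

text \<open>Every column contains a 1, and two columns cannot have their 1 in the same row because their
  supports are disjoint.\<close>

lemma isometry_obtain_selection:
  assumes n: "n \<ge> 1" and X: "X \<in> max_isometries n k"
  obtains \<sigma> where "inj_on \<sigma> {..<k}" "\<And>j. j < k \<Longrightarrow> \<sigma> j < n" "\<And>j. j < k \<Longrightarrow> X $$ (\<sigma> j, j) = 1"
proof -
  note X = X[unfolded max_isometries_iff[OF n]]
  have "\<forall>j. \<exists>r. j < k \<longrightarrow> r < n \<and> X $$ (r, j) = 1" using X by blast
  then obtain \<sigma> where \<sigma>: "\<And>j. j < k \<Longrightarrow> \<sigma> j < n \<and> X $$ (\<sigma> j, j) = 1" by metis
  have "inj_on \<sigma> {..<k}"
  proof (rule inj_onI, rule ccontr)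
    fix i j assume *: "i \<in> {..<k}" "j \<in> {..<k}" "\<sigma> i = \<sigma> j" "i \<noteq> j"
    then have "i < k" "j < k" "\<sigma> j < n" using \<sigma> by auto
    then have "X $$ (\<sigma> j, i) * X $$ (\<sigma> j, j) = 0" using X \<open>i \<noteq> j\<close> by blast
    moreover have "X $$ (\<sigma> j, i) = 1" "X $$ (\<sigma> j, j) = 1" using * \<sigma>[of i] \<sigma>[of j] by auto
    ultimately show False by simp
  qed
  with \<sigma> that show ?thesis by blast
qed

lemma max_form_isometry_le:
  assumes n: "n \<ge> 1" and k: "k \<ge> 1" and A: "A \<in> carrier_mat n n" "nonneg_mat A"
    and X: "X \<in> max_isometries n k"
    and d: "\<And>r s. r < n \<Longrightarrow> s < n \<Longrightarrow> A $$ (r, s) \<le> d"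
  shows "max_form A n k X \<le> d"
proof (rule max_form_le[OF n k])
  fix j r s assume *: "j < k" "r < n" "s < n"
  note X = X[unfolded max_isometries_iff[OF n]]
  have a: "0 \<le> A $$ (r, s)" using A * by (auto simp: nonneg_mat_def)
  have x: "0 \<le> X $$ (r, j)" "X $$ (r, j) \<le> 1" "0 \<le> X $$ (s, j)" "X $$ (s, j) \<le> 1"
    using X * by auto
  have "X $$ (r, j) * A $$ (r, s) * X $$ (s, j) \<le> X $$ (r, j) * A $$ (r, s)"
    using a x by (intro mult_left_le) auto
  also have "\<dots> \<le> A $$ (r, s)" using a x by (simp add: mult_left_le_one_le)
  finally show "X $$ (r, j) * A $$ (r, s) * X $$ (s, j) \<le> d" using d[of r s] * by simp
qed

text \<open>In the square case the selected rows are all the rows, so a second nonzero entry in a column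
  would lie in a row whose 1 belongs to another column.\<close>

lemma max_form_square_isometry:
  assumes n: "n \<ge> 1" and A: "A \<in> carrier_mat n n" "nonneg_mat A" and X: "X \<in> max_isometries n n"
  shows "max_form A n n X = max_diag A n id"
proof -
  obtain \<sigma> where inj: "inj_on \<sigma> {..<n}" and \<sigma>: "\<And>j. j < n \<Longrightarrow> \<sigma> j < n"
    and one: "\<And>j. j < n \<Longrightarrow> X $$ (\<sigma> j, j) = 1"
    using isometry_obtain_selection[OF n X] by blast
  have surj: "\<sigma> ` {..<n} = {..<n}"
    using inj \<sigma> by (intro endo_inj_surj) auto
  have "X $$ (r, j) = (if r = \<sigma> j then 1 else 0)" if rj: "r < n" "j < n" for r j
  proof (cases "r = \<sigma> j")
    case False
    obtain i where i: "i < n" "r = \<sigma> i" using surj rj by blast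
    with False have "i \<noteq> j" by auto
    with X i rj have "X $$ (r, i) * X $$ (r, j) = 0" unfolding max_isometries_iff[OF n] by blast
    with one i False show ?thesis by simp
  qed (use one rj in simp)
  with max_form_selection_le[OF n n A \<sigma>] max_diag_le_max_form[of n \<sigma> n X A] n \<sigma> one
  have "max_form A n n X = max_diag A n \<sigma>" by (intro antisym) auto
  also have "\<dots> = max_diag A n id" using surj by (intro max_diag_cong_image) simp
  finally show ?thesis .
qed

section \<open>Attaining intermediate values\<close>

definition fill_mat :: "nat \<Rightarrow> nat \<Rightarrow> (nat \<Rightarrow> nat) \<Rightarrow> nat \<Rightarrow> nat set \<Rightarrow> real \<Rightarrow> real mat" where
  "fill_mat n k \<sigma> j0 R t =
    mat n k (\<lambda>(r, j). if r = \<sigma> j then 1 else if r \<in> R \<and> j = j0 then t else 0)"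

lemma fill_mat_isometry:
  assumes n: "n \<ge> 1" and inj: "inj_on \<sigma> {..<k}" and \<sigma>: "\<And>j. j < k \<Longrightarrow> \<sigma> j < n"
    and R: "R \<inter> \<sigma> ` {..<k} = {}" and t: "0 \<le> t" "t \<le> 1"
  shows "fill_mat n k \<sigma> j0 R t \<in> max_isometries n k"
proof -
  have "fill_mat n k \<sigma> j0 R t $$ (r, i) * fill_mat n k \<sigma> j0 R t $$ (r, j) = 0"
    if "r < n" "i < k" "j < k" "i \<noteq> j" for r i j
    using that inj R by (auto simp: fill_mat_def dest: inj_onD)
  moreover have "\<exists>r<n. fill_mat n k \<sigma> j0 R t $$ (r, j) = 1" if "j < k" for j
    using that \<sigma> by (intro exI[of _ "\<sigma> j"]) (auto simp: fill_mat_def)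
  ultimately show ?thesis
    unfolding max_isometries_iff[OF n] using t by (auto simp: fill_mat_def)
qed

text \<open>The value depends continuously on the height \<open>t\<close> of the raised entries, and at height 0 it is
  the value of the bare selection \<open>\<sigma>\<close>.\<close>

lemma values_along_fill_path:
  assumes n: "n \<ge> 1" and k: "k \<ge> 1" and A: "A \<in> carrier_mat n n" "nonneg_mat A"
    and inj: "inj_on \<sigma> {..<k}" and \<sigma>: "\<And>j. j < k \<Longrightarrow> \<sigma> j < n"
    and R: "R \<inter> \<sigma> ` {..<k} = {}"
    and v: "max_diag A k \<sigma> \<le> v" "v \<le> max_form A n k (fill_mat n k \<sigma> j0 R 1)"
  shows "v \<in> max_numerical_range k A"
proof -
  let ?X = "fill_mat n k \<sigma> j0 R"
  have "{..<k} \<times> {..<n} \<times> {..<n} \<noteq> {}" using n k by (auto simp: lessThan_empty_iff)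
  moreover have entry: "continuous_on {0..1} (\<lambda>t. ?X t $$ (r, j))" if "r < n" "j < k" for r j
    using that by (cases "r = \<sigma> j"; cases "r \<in> R \<and> j = j0") (auto simp: fill_mat_def)
  ultimately have "continuous_on {0..1} (\<lambda>t. max_form A n k (?X t))"
    unfolding max_form_def
    by (intro continuous_on_Max_image) (auto intro!: continuous_on_mult continuous_on_const entry)
  moreover have "max_form A n k (?X 0) \<le> max_diag A k \<sigma>"
    by (rule max_form_selection_le[OF n k A \<sigma>]) (auto simp: fill_mat_def)
  ultimately obtain t where "0 \<le> t" "t \<le> 1" "max_form A n k (?X t) = v"
    using IVT'[of "\<lambda>t. max_form A n k (?X t)" 0 v 1] v by auto
  then show ?thesis
    unfolding max_numerical_range_eq[OF n k A(1)]
    using fill_mat_isometry[OF n inj \<sigma> R, of t j0] by blast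
qed

text \<open>The rows \<open>p\<close> and \<open>q\<close> fit into one column unless \<open>\<sigma>\<close> places them into different columns. Rows
  not selected by \<open>\<sigma>\<close> are raised in the column of the selected one, or in any column if neither is
  selected.\<close>

lemma values_up_to_entry:
  assumes n: "n \<ge> 1" and k: "k \<ge> 1" and A: "A \<in> carrier_mat n n" "nonneg_mat A"
    and inj: "inj_on \<sigma> {..<k}" and \<sigma>: "\<And>j. j < k \<Longrightarrow> \<sigma> j < n"
    and pq: "p < n" "q < n" "p = q \<or> p \<notin> \<sigma> ` {..<k} \<or> q \<notin> \<sigma> ` {..<k}"
    and v: "max_diag A k \<sigma> \<le> v" "v \<le> A $$ (p, q)"
  shows "v \<in> max_numerical_range k A"
proof -
  define R where "R = {p, q} - \<sigma> ` {..<k}"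
  have "\<exists>j<k. {p, q} \<subseteq> insert (\<sigma> j) R"
  proof (cases "p \<in> \<sigma> ` {..<k} \<or> q \<in> \<sigma> ` {..<k}")
    case True
    then show ?thesis using pq(3) unfolding R_def by blast
  next
    case False
    then show ?thesis using k unfolding R_def by (intro exI[of _ 0]) auto
  qed
  then obtain j where j: "j < k" "{p, q} \<subseteq> insert (\<sigma> j) R" by blast
  have "fill_mat n k \<sigma> j R 1 $$ (r, j) = 1" if "r < n" "r \<in> {p, q}" for r
    using that j by (auto simp: fill_mat_def)
  then have "A $$ (p, q) \<le> max_form A n k (fill_mat n k \<sigma> j R 1)"
    using max_form_ge[OF j(1) pq(1,2), of "fill_mat n k \<sigma> j R 1" A] pq by simp
  with v show ?thesis
    by (intro values_along_fill_path[OF n k A inj \<sigma>, of R v j]) (auto simp: R_def)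
qed

text \<open>When \<open>\<sigma>\<close> places \<open>p\<close> and \<open>q\<close> into different columns, the unused row \<open>e\<close> replaces \<open>q\<close>. The value
  \<open>F\<close> with \<open>e\<close> and \<open>q\<close> both at height 1 in one column separates the two ranges of values that the
  two paths have to cover.\<close>

lemma values_from_selection_to_entry:
  assumes n: "n \<ge> 1" and k: "k \<ge> 1" "k < n" and A: "A \<in> carrier_mat n n" "nonneg_mat A"
    and inj: "inj_on \<sigma> {..<k}" and \<sigma>: "\<And>j. j < k \<Longrightarrow> \<sigma> j < n"
    and pq: "p < n" "q < n"
    and v: "max_diag A k \<sigma> \<le> v" "v \<le> A $$ (p, q)"
  shows "v \<in> max_numerical_range k A"
proof (cases "p = q \<or> p \<notin> \<sigma> ` {..<k} \<or> q \<notin> \<sigma> ` {..<k}")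
  case True
  show ?thesis by (rule values_up_to_entry[OF n k(1) A inj \<sigma> pq True v])
next
  case False
  then obtain j where j: "j < k" "q = \<sigma> j" and "p \<noteq> q" by blast
  have "card (\<sigma> ` {..<k}) < card {..<n}" using inj k by (simp add: card_image)
  then have "\<not> {..<n} \<subseteq> \<sigma> ` {..<k}"
    by (meson card_mono finite_imageI finite_lessThan not_le)
  then obtain e where e: "e < n" "e \<notin> \<sigma> ` {..<k}" by blast
  define F where "F = max_form A n k (fill_mat n k \<sigma> j {e} 1)"
  show ?thesis
  proof (cases "v \<le> F")
    case True
    then show ?thesis
      using e v unfolding F_def by (intro values_along_fill_path[OF n k(1) A inj \<sigma>, of "{e}" v j]) auto
  next
    case False
    define \<tau> where "\<tau> = \<sigma>(j := e)"
    have \<tau>: "\<And>i. i < k \<Longrightarrow> \<tau> i < n" using \<sigma> e by (auto simp: \<tau>_def)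
    have inj\<tau>: "inj_on \<tau> {..<k}"
      using inj e unfolding \<tau>_def by (auto simp: inj_on_def image_iff)
    have q: "q \<notin> \<tau> ` {..<k}"
      using inj e j unfolding \<tau>_def by (auto simp: inj_on_def image_iff)
    have "max_diag A k \<tau> \<le> F"
      unfolding F_def using k \<tau> e by (intro max_diag_le_max_form) (auto simp: fill_mat_def \<tau>_def)
    with False v(2) q show ?thesis
      by (intro values_up_to_entry[OF n k(1) A inj\<tau> \<tau> pq]) auto
  qed
qed

section \<open>The numerical ranges\<close>

theorem theorem3p13:
  fixes A :: "real mat" and n :: nat
  assumes "n \<ge> 1"
    and "A \<in> carrier_mat n n"
    and "nonneg_mat A"
  shows "(\<forall>k. 1 \<le> k \<and> k < n \<longrightarrow>
            max_numerical_range k A =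
              {Min {Max {A $$ (i j, i j) | j. j < k} | i :: nat \<Rightarrow> nat.
                      strict_mono_on {..<k} i \<and> (\<forall>j<k. i j < n)}
               .. Max {A $$ (i, j) | i j. i < n \<and> j < n}})
         \<and> max_numerical_range n A = {Max {A $$ (i, i) | i. i < n}}"
proof (intro conjI allI impI)
  note n = assms(1) and A = assms(2,3)
  fix k assume "1 \<le> k \<and> k < n"
  then have k: "k \<ge> 1" "k < n" by auto
  define C where "C = max_diag A k ` {i. strict_mono_on {..<k} i \<and> (\<forall>j<k. i j < n)}"
  define D where "D = (\<lambda>(r, s). A $$ (r, s)) ` ({..<n} \<times> {..<n})"
  have C: "{Max {A $$ (i j, i j) | j. j < k} | i :: nat \<Rightarrow> nat.
                      strict_mono_on {..<k} i \<and> (\<forall>j<k. i j < n)} = C"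
    unfolding C_def max_diag_def by (auto simp: setcompr_eq_image lessThan_def)
  have D: "{A $$ (i, j) | i j. i < n \<and> j < n} = D"
    unfolding D_def by force
  have "max_diag A k i \<in> (\<lambda>r. A $$ (r, r)) ` {..<n}" if i: "\<forall>j<k. i j < n" for i
  proof -
    have "max_diag A k i \<in> (\<lambda>j. A $$ (i j, i j)) ` {..<k}"
      unfolding max_diag_def using k by (intro Max_in) (auto simp: lessThan_empty_iff)
    with i show ?thesis by auto
  qed
  then have "C \<subseteq> (\<lambda>r. A $$ (r, r)) ` {..<n}" unfolding C_def by auto
  then have finC: "finite C" by (rule finite_subset) simp
  have "max_diag A k id \<in> C"
    unfolding C_def using k by (auto simp: strict_mono_on_def)
  then have neC: "C \<noteq> {}" by auto
  have finD: "finite D" unfolding D_def by simp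
  have neD: "D \<noteq> {}" unfolding D_def using n by (auto simp: lessThan_empty_iff)
  have le_D: "A $$ (r, s) \<le> Max D" if "r < n" "s < n" for r s
    using that finD unfolding D_def by (intro Max_ge) force+
  have "max_numerical_range k A = {Min C..Max D}"
  proof (intro equalityI subsetI)
    fix v assume "v \<in> max_numerical_range k A"
    then obtain X where X: "X \<in> max_isometries n k" and v: "v = max_form A n k X"
      unfolding max_numerical_range_eq[OF n k(1) A(1)] by blast
    obtain \<sigma> where inj: "inj_on \<sigma> {..<k}" and \<sigma>: "\<And>j. j < k \<Longrightarrow> \<sigma> j < n"
      and one: "\<And>j. j < k \<Longrightarrow> X $$ (\<sigma> j, j) = 1"
      using isometry_obtain_selection[OF n X] by blast
    \<comment> \<open>Only increasing selections occur in \<open>C\<close>; sorting the image of \<open>\<sigma>\<close> does not change the value.\<close>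
    have card: "card (\<sigma> ` {..<k}) = k" using inj by (simp add: card_image)
    obtain i where "bij_betw i {..<k} (\<sigma> ` {..<k})" and mono: "strict_mono_on {..<k} i"
      using ex_bij_betw_strict_mono_card[of "\<sigma> ` {..<k}"] unfolding card by auto
    then have img: "i ` {..<k} = \<sigma> ` {..<k}" by (simp add: bij_betw_def)
    then have "\<forall>j<k. i j < n" using \<sigma> by (metis imageE imageI lessThan_iff)
    with mono have "max_diag A k i \<in> C" unfolding C_def by blast
    then have "Min C \<le> max_diag A k \<sigma>"
      using finC max_diag_cong_image[OF img] by (metis Min_le)
    also have "\<dots> \<le> v" unfolding v using k \<sigma> one by (intro max_diag_le_max_form) auto
    finally show "v \<in> {Min C..Max D}"
      using max_form_isometry_le[OF n k(1) A X le_D] v by simp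
  next
    fix v assume v: "v \<in> {Min C..Max D}"
    obtain \<sigma> where mono: "strict_mono_on {..<k} \<sigma>" and \<sigma>: "\<forall>j<k. \<sigma> j < n"
      and c: "Min C = max_diag A k \<sigma>"
      using Min_in[OF finC neC] unfolding C_def by blast
    obtain p q where pq: "p < n" "q < n" and d: "Max D = A $$ (p, q)"
      using Max_in[OF finD neD] unfolding D_def by auto
    show "v \<in> max_numerical_range k A"
      using v \<sigma> strict_mono_on_imp_inj_on[OF mono]
      by (intro values_from_selection_to_entry[OF n k A _ _ pq, of \<sigma>]) (auto simp: c d)
  qed
  then show "max_numerical_range k A =
      {Min {Max {A $$ (i j, i j) | j. j < k} | i :: nat \<Rightarrow> nat.
              strict_mono_on {..<k} i \<and> (\<forall>j<k. i j < n)}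
       .. Max {A $$ (i, j) | i j. i < n \<and> j < n}}"
    unfolding C D .
next
  note n = assms(1) and A = assms(2,3)
  have "max_isometries n n \<noteq> {}"
    using fill_mat_isometry[OF n, of id n "{}" 0 0] by auto
  then have "max_numerical_range n A = {max_diag A n id}"
    unfolding max_numerical_range_eq[OF n n A(1)]
    using max_form_square_isometry[OF n A] by (auto simp: image_iff)
  moreover have "{A $$ (i, i) | i. i < n} = (\<lambda>j. A $$ (id j, id j)) ` {..<n}" by auto
  ultimately show "max_numerical_range n A = {Max {A $$ (i, i) | i. i < n}}"
    by (simp add: max_diag_def)
qed

end
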